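(* Let $n,m,k$ be integers with $2\le m\le n$ and $2\le k\le 2^{m-1}+1$. Then $$v_2\big(s(2^n,2^m-k)\big)=2^n-2^m-(n-m)\Big(2^m-2\Big\lfloor\frac{k}{2}\Big\rfloor\Big)+m-2-v_2\Big(\Big\lfloor\frac{k}{2}\Big\rfloor\Big)+(n-1)\epsilon_k,$$ where $\epsilon_k=0$ if $k$ is even and $\epsilon_k=1$ if $k$ is odd.
   Context: For nonnegative integers $n$, the Pochhammer symbol is $(x)_n=x(x+1)\cdots(x+n-1)$ (with $(x)_0=1$). The (unsigned) Stirling numbers of the first kind $s(n,k)$ are defined by $(x)_n=\sum_{k=0}^n s(n,k)x^k$, and $s(n,k)=0$ for $k>n$. For a nonzero rational $x=n_1/n_2$, $v_2(x)=v_2(n_1)-v_2(n_2)$, where $v_2$ of a nonzero integer is the exponent of the largest power of $2$ dividing it. $\lfloor y\rfloor$ is the floor of $y$. *)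

theory Defs
  imports "HOL-Combinatorics.Stirling" "HOL-Computational_Algebra.Computational_Algebra"
begin

(* 2-adic valuation of a nonzero natural number; the unsigned Stirling numbers of the
   first kind are the library's  stirling n k  (defined by the standard recurrence,
   equivalent to (x)_n = sum_k s(n,k) x^k, see lemma stirling_row / pochhammer). *)
definition v2 :: "nat \<Rightarrow> nat" where
  "v2 x = multiplicity (2::nat) x"

end

theory Submission
  imports Defs
begin

text \<open>
  The doubling formula for rising factorials, together with squaring of congruences modulo
  powers of two, shows that \<open>pochhammer (2 ^ (n - m) * y) (2 ^ n)\<close> equals
  \<open>2 ^ (2 ^ n - 2 ^ m) * H(y)\<close>, where \<open>H\<close> is congruent to an odd multiple of
  \<open>y ^ (2 ^ (m - 1)) * (y\<^sup>2 + 1) ^ (2 ^ (m - 2))\<close> modulo \<open>2 ^ (m - 1)\<close>. For even \<open>k\<close>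
  the valuation is therefore that of the binomial coefficient of \<open>2 ^ (m - 2)\<close> over
  \<open>k / 2\<close>. For odd \<open>k\<close>, the reflection \<open>(y - M) * H(- y) = y * H(y - M)\<close> with
  \<open>M = 2 ^ m\<close> gives \<open>2 * h j = M * j * h (j + 1)\<close> modulo \<open>M\<^sup>2\<close> for the
  coefficients \<open>h j\<close> of \<open>H\<close> with \<open>j\<close> odd, which reduces to the even case.
\<close>

section \<open>Congruences in commutative rings\<close>

lemma dvd_mult_diff:
  fixes a b c d e :: "'a::comm_ring_1"
  assumes "e dvd a - c" "e dvd b - d"
  shows "e dvd a * b - c * d"
proof -
  have "a * b - c * d = (a - c) * b + c * (b - d)" by (simp add: algebra_simps)
  then show ?thesis using assms by simp
qed

lemma dvd_prod_diff:
  fixes f g :: "'b \<Rightarrow> 'a::comm_ring_1"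
  assumes "\<And>i. i \<in> A \<Longrightarrow> e dvd f i - g i"
  shows "e dvd prod f A - prod g A"
  using assms
  by (induction A rule: infinite_finite_induct) (auto intro!: dvd_mult_diff)

lemma dvd_pochhammer_diff:
  fixes x y :: "'a::comm_ring_1"
  assumes "e dvd x - y"
  shows "e dvd pochhammer x n - pochhammer y n"
  unfolding pochhammer_prod by (rule dvd_prod_diff) (use assms in simp)

text \<open>The factor \<open>p + q = (p - q) + 2 * q\<close> of the difference of squares is even
  because \<open>a \<ge> 1\<close>; it supplies the extra power of two.\<close>

lemma two_power_dvd_square_diff:
  fixes p q :: "'a::comm_ring_1"
  assumes "2 ^ a dvd p - q" "a \<ge> 1"
  shows "2 ^ Suc a dvd p\<^sup>2 - q\<^sup>2"
proof -
  have "2 dvd p - q"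
    using assms by (meson dvd_power dvd_trans less_le_trans zero_less_one)
  then have "2 dvd (p - q) + 2 * q" by (intro dvd_add dvd_triv_left)
  also have "(p - q) + 2 * q = p + q" by simp
  finally have "2 dvd p + q" .
  with assms(1) have "2 * 2 ^ a dvd (p + q) * (p - q)" by (intro mult_dvd_mono)
  then show ?thesis by (simp add: algebra_simps power2_eq_square)
qed

text \<open>Split a product of length \<open>2 * N\<close>, \<open>N = 2 ^ (a + 2)\<close>, into
  halves. Shifting by \<open>N\<close> is invisible modulo \<open>N\<close>, so the product is the
  square of its first half, and squaring raises the modulus of the induction hypothesis by one
  power.\<close>

lemma pochhammer_two_power_cong:
  fixes x :: "'a::comm_ring_1"
  shows "2 ^ Suc a dvd pochhammer x (2 ^ (a + 2)) - x ^ (2 ^ Suc a) * (x\<^sup>2 + 1) ^ (2 ^ a)"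
proof (induction a)
  case 0
  have "pochhammer x 4 - x\<^sup>2 * (x\<^sup>2 + 1) = 2 * (3 * x ^ 3 + 5 * x ^ 2 + 3 * x)"
    by (simp add: pochhammer_Suc numeral_eq_Suc algebra_simps)
  then have "2 dvd pochhammer x 4 - x\<^sup>2 * (x\<^sup>2 + 1)" by (simp only: dvd_triv_left)
  then show ?case by simp
next
  case (Suc a)
  define N :: nat where "N = 2 ^ (a + 2)"
  define P where "P = pochhammer x N"
  define F where "F = x ^ (2 ^ Suc a) * (x\<^sup>2 + 1) ^ (2 ^ a)"
  have "(2::'a) ^ (a + 2) dvd of_nat N" by (simp add: N_def)
  then have "2 ^ (a + 2) dvd pochhammer (x + of_nat N) N - P"
    unfolding P_def by (intro dvd_pochhammer_diff) simp
  then have "2 ^ (a + 2) dvd P * (pochhammer (x + of_nat N) N - P)" by (rule dvd_mult)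
  moreover have "pochhammer x (2 ^ (Suc a + 2)) = P * pochhammer (x + of_nat N) N"
    unfolding P_def pochhammer_product'[symmetric] by (simp add: N_def)
  moreover have "2 ^ (a + 2) dvd P\<^sup>2 - F\<^sup>2"
    using two_power_dvd_square_diff[of "Suc a" P F] Suc by (simp add: P_def F_def N_def)
  ultimately have "2 ^ (a + 2) dvd
      P * (pochhammer (x + of_nat N) N - P) + (P\<^sup>2 - F\<^sup>2)"
    by simp
  also have "\<dots> = pochhammer x (2 ^ (Suc a + 2)) - F\<^sup>2"
    using \<open>pochhammer x (2 ^ (Suc a + 2)) = _\<close> by (simp add: algebra_simps power2_eq_square)
  also have "F\<^sup>2 = x ^ (2 ^ Suc (Suc a)) * (x\<^sup>2 + 1) ^ (2 ^ Suc a)"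
    by (simp add: F_def power_mult_distrib flip: power_mult) (simp add: mult.commute)
  finally show ?case by simp
qed

text \<open>These are the odd-indexed factors of \<open>pochhammer (2 * x) (2 * n)\<close>; the
  even-indexed ones are the doubled factors of \<open>pochhammer x n\<close>.\<close>

definition odd_factors :: "nat \<Rightarrow> 'a::comm_ring_1 \<Rightarrow> 'a" where
  "odd_factors n x = (\<Prod>i<n. 2 * x + of_nat (2 * i + 1))"

lemma pochhammer_double_odd_factors:
  "pochhammer (2 * x) (2 * n) = 2 ^ n * pochhammer x n * odd_factors n (x :: 'a::comm_ring_1)"
  by (induction n) (simp_all add: odd_factors_def pochhammer_Suc algebra_simps)

lemma odd_factors_add:
  "odd_factors (n + k) x = odd_factors n x * odd_factors k (x + of_nat n)"
proof -
  have "odd_factors k (x + of_nat n) = (\<Prod>i<k. 2 * x + of_nat (2 * (n + i) + 1))"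
    unfolding odd_factors_def by (intro prod.cong) (auto simp: algebra_simps)
  then show ?thesis
    unfolding odd_factors_def by (induction k ) (simp_all add: algebra_simps)
qed

text \<open>Allows \<open>x\<close> to be replaced by \<open>0\<close>, which leaves an odd
  constant. The induction again reduces a doubled product to a square.\<close>

lemma odd_factors_two_power_cong:
  fixes x y :: "'a::comm_ring_1"
  shows "2 ^ n dvd odd_factors (2 ^ n) x - odd_factors (2 ^ n) y"
proof (induction n)
  case 0
  then show ?case by simp
next
  case (Suc n)
  let ?O = "odd_factors (2 ^ n) :: 'a \<Rightarrow> 'a"
  have shift: "2 ^ Suc n dvd ?O (z + 2 ^ n) - ?O z" for z
    unfolding odd_factors_def by (rule dvd_prod_diff) (simp add: algebra_simps)
  have split: "2 ^ Suc n dvd odd_factors (2 ^ Suc n) z - (?O z)\<^sup>2" for z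
  proof -
    have "odd_factors (2 ^ Suc n) z - (?O z)\<^sup>2 = ?O z * (?O (z + 2 ^ n) - ?O z)"
      using odd_factors_add[of "2 ^ n" "2 ^ n" z]
      by (simp add: algebra_simps power2_eq_square mult_2)
    then show ?thesis using shift by simp
  qed
  have "2 ^ Suc n dvd (?O x)\<^sup>2 - (?O y)\<^sup>2"
  \<comment> \<open>For \<open>n = 0\<close> the induction hypothesis is a congruence modulo 1, too
    weak for squaring, so this case is computed.\<close>
  proof (cases "n = 0")
    case True
    then have "(?O x)\<^sup>2 - (?O y)\<^sup>2 = 2 * (2 * (x - y) * (x + y + 1))"
      by (simp add: odd_factors_def algebra_simps power2_eq_square)
    with True show ?thesis by (metis dvd_triv_left power_one_right One_nat_def)
  next
    case False
    with Suc show ?thesis by (intro two_power_dvd_square_diff) auto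
  qed
  from dvd_add[OF dvd_diff[OF split[of x] split[of y]] this] show ?case
    by (simp add: algebra_simps)
qed

text \<open>Both sides are the product of \<open>x - n, ..., x\<close>; the sign
  \<open>(-1) ^ n\<close> disappears because \<open>n\<close> is even.\<close>

lemma pochhammer_reflect:
  fixes x :: "'a::comm_ring_1"
  assumes "even n"
  shows "(x - of_nat n) * pochhammer (- x) n = x * pochhammer (x - of_nat n) n"
proof -
  have "pochhammer (- x) n = pochhammer (x - of_nat n + 1) n"
    using assms by (simp add: pochhammer_minus)
  then have "(x - of_nat n) * pochhammer (- x) n = pochhammer (x - of_nat n) (Suc n)"
    by (simp add: pochhammer_rec)
  also have "\<dots> = x * pochhammer (x - of_nat n) n"
    by (simp add: pochhammer_Suc mult.commute)
  finally show ?thesis .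
qed

section \<open>The rescaled rising factorial\<close>

lemma pcompose_pochhammer:
  fixes p q :: "'a::comm_ring_1 poly"
  shows "pcompose (pochhammer p n) q = pochhammer (pcompose p q) n"
  by (induction n)
    (simp_all add: pochhammer_Suc pcompose_mult pcompose_add pcompose_1 of_nat_poly)

lemma coeff_pochhammer_linear:
  fixes a :: "'a::comm_ring_1"
  shows "coeff (pochhammer [:0, a:] n) j = of_nat (stirling n j) * a ^ j"
proof -
  have eq: "of_nat (stirling n k) * [:0, a:] ^ k = monom (of_nat (stirling n k) * a ^ k) k" for k
    using smult_power[of a "[:0, 1:]" k] by (simp add: of_nat_poly monom_altdef mult.commute)
  have "pochhammer [:0, a:] n = (\<Sum>k\<le>n. monom (of_nat (stirling n k) * a ^ k) k)"
    by (simp only: eq flip: stirling_pochhammer)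
  then show ?thesis
    by (auto simp: coeff_sum coeff_monom)
qed

lemma two_power_poly: "(2::int poly) ^ n = [:2 ^ n:]"
  by (simp add: poly_const_pow numeral_poly)

text \<open>Induction on \<open>d\<close> by the doubling formula: each step contributes
  \<open>2 ^ N\<close> and a cofactor that is an odd constant modulo \<open>2 ^ Suc a\<close>. In
  the application \<open>a + 2\<close> is \<open>m\<close> and \<open>d\<close> is
  \<open>n - m\<close>.\<close>

lemma pochhammer_rescale:
  defines "X \<equiv> [:0, 1:] :: int poly"
  shows "\<exists>H c. odd c \<and>
    pochhammer [:0, 2 ^ d:] (2 ^ (a + 2 + d)) = 2 ^ (2 ^ (a + 2 + d) - 2 ^ (a + 2)) * H \<and>
    2 ^ Suc a dvd H - of_int c * (X ^ (2 ^ Suc a) * (X\<^sup>2 + 1) ^ (2 ^ a))"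
proof (induction d)
  case 0
  show ?case
    by (intro exI[of _ "pochhammer X (2 ^ (a + 2))"] exI[of _ 1])
      (use pochhammer_two_power_cong[of a X] in \<open>simp add: X_def\<close>)
next
  case (Suc d)
  define F where "F = X ^ (2 ^ Suc a) * (X\<^sup>2 + 1) ^ (2 ^ a)"
  define Y :: "int poly" where "Y = [:0, 2 ^ d:]"
  define N :: nat where "N = 2 ^ (a + 2 + d)"
  obtain H c where H: "odd c" "pochhammer Y N = 2 ^ (N - 2 ^ (a + 2)) * H"
      "2 ^ Suc a dvd H - of_int c * F"
    using Suc by (auto simp: F_def Y_def N_def)
  \<comment> \<open>At \<open>0\<close> the odd factors are \<open>1, 3, 5, ...\<close>, so
    \<open>c'\<close> is odd.\<close>
  define c' :: int where "c' = odd_factors N 0"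
  have c': "of_int c' = (odd_factors N 0 :: int poly)"
    by (simp add: c'_def odd_factors_def)
  have "(2::int poly) ^ (a + 2 + d) dvd odd_factors N Y - of_int c'"
    unfolding c' N_def by (rule odd_factors_two_power_cong)
  moreover have "(2::int poly) ^ Suc a dvd 2 ^ (a + 2 + d)"
    by (rule le_imp_power_dvd) simp
  ultimately have "2 ^ Suc a dvd odd_factors N Y - of_int c'" by (rule dvd_trans[rotated])
  then have "2 ^ Suc a dvd odd_factors N Y * H - of_int c' * (of_int c * F)"
    using H(3) by (rule dvd_mult_diff)
  moreover have "odd (c' * c)"
    using H(1) by (simp add: c'_def odd_factors_def even_prod_iff)
  moreover have "pochhammer [:0, 2 ^ Suc d:] (2 ^ (a + 2 + Suc d)) =
      2 ^ (2 ^ (a + 2 + Suc d) - 2 ^ (a + 2)) * (odd_factors N Y * H)"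
  proof -
    have "2 ^ (a + 2) \<le> N" by (simp add: N_def)
    then have "2 ^ (a + 2 + Suc d) - 2 ^ (a + 2) = N + (N - 2 ^ (a + 2))"
      by (simp add: N_def)
    moreover have "[:0, 2 ^ Suc d:] = 2 * Y" by (simp add: Y_def numeral_poly)
    moreover have "2 ^ (a + 2 + Suc d) = 2 * N" by (simp add: N_def)
    ultimately show ?thesis
      by (simp only: pochhammer_double_odd_factors H(2) power_add) (simp only: mult_ac)
  qed
  ultimately show ?case
    unfolding F_def[symmetric]
    by (intro exI[of _ "odd_factors N Y * H"] exI[of _ "c' * c"]) (simp add: mult.assoc)
qed

lemma pcompose_shift_taylor:
  fixes p :: "'a::idom poly"
  shows "\<exists>g. pcompose p [:a, 1:] = p + smult a (pderiv p) + smult (a\<^sup>2) g"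
proof (induction p)
  case 0
  show ?case by (intro exI[of _ 0]) simp
next
  case (pCons b p)
  then obtain g where g: "pcompose p [:a, 1:] = p + smult a (pderiv p) + smult (a\<^sup>2) g" by blast
  show ?case
    \<comment> \<open>The constant part of \<open>[:a, 1:]\<close> times the first-order term
      \<open>smult a (pderiv p)\<close> yields the new summand \<open>pderiv p\<close> of the
      remainder.\<close>
    by (intro exI[of _ "pderiv p + [:a, 1:] * g"])
      (simp add: pcompose_pCons g pderiv_pCons algebra_simps power2_eq_square smult_add_right)
qed

text \<open>Expand \<open>H(X - M)\<close> to first order and compare coefficients at
  \<open>Suc j\<close>. As \<open>j\<close> is odd, \<open>H(- X)\<close> contributes
  \<open>- coeff H j\<close>, so the two copies of \<open>coeff H j\<close> add up instead of
  cancelling.\<close>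

lemma odd_coeff_cong:
  fixes H :: "int poly" and M :: int
  assumes "[:- M, 1:] * pcompose H [:0, - 1:] = [:0, 1:] * pcompose H [:- M, 1:]"
    and "odd j"
  shows "M\<^sup>2 dvd 2 * coeff H j - M * int j * coeff H (Suc j)"
proof -
  obtain g where g: "pcompose H [:- M, 1:] = H + smult (- M) (pderiv H) + smult ((- M)\<^sup>2) g"
    using pcompose_shift_taylor by blast
  have "coeff ([:- M, 1:] * pcompose H [:0, - 1:]) (Suc j) =
      coeff ([:0, 1:] * pcompose H [:- M, 1:]) (Suc j)"
    using assms(1) by simp
  then have "- M * coeff H (Suc j) - coeff H j =
      coeff H j - M * (int j + 1) * coeff H (Suc j) + M\<^sup>2 * coeff g j"
    using \<open>odd j\<close> unfolding g
    by (simp add: coeff_pcompose_linear coeff_pderiv algebra_simps)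
  then have "2 * coeff H j - M * int j * coeff H (Suc j) = M\<^sup>2 * (- coeff g j)"
    by (simp add: algebra_simps)
  then show ?thesis by (metis dvd_triv_left)
qed

text \<open>This is the reflection formula at \<open>Y = 2 ^ d * X\<close>: since
  \<open>Y - N = 2 ^ d * (X - 2 ^ m)\<close>, the shift by \<open>N\<close> becomes a shift by
  \<open>2 ^ m\<close>, and the common factor \<open>2 ^ (C + d)\<close> cancels.\<close>

lemma rescaled_functional_equation:
  fixes H :: "int poly"
  assumes "pochhammer [:0, 2 ^ d:] (2 ^ (m + d)) = 2 ^ C * H" and "m \<ge> 1"
  shows "[:- (2 ^ m), 1:] * pcompose H [:0, - 1:] = [:0, 1:] * pcompose H [:- (2 ^ m), 1:]"
proof -
  define N :: nat where "N = 2 ^ (m + d)"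
  define Y :: "int poly" where "Y = [:0, 2 ^ d:]"
  have C: "pcompose (2 ^ C * H) q = 2 ^ C * pcompose H q" for q
    by (simp add: two_power_poly pcompose_smult)
  have N: "of_nat N = [:2 ^ d * 2 ^ m :: int:]"
    by (simp add: N_def two_power_poly power_add mult.commute)
  have 1: "pochhammer (- Y) N = 2 ^ C * pcompose H [:0, - 1:]"
    using arg_cong[OF assms(1), of "\<lambda>p. pcompose p [:0, - 1:]"]
    by (simp add: pcompose_pochhammer C Y_def N_def pcompose_pCons)
  have 2: "pochhammer (Y - of_nat N) N = 2 ^ C * pcompose H [:- (2 ^ m), 1:]"
    using arg_cong[OF assms(1), of "\<lambda>p. pcompose p [:- (2 ^ m), 1:]"]
    unfolding N by (simp add: pcompose_pochhammer C Y_def pcompose_pCons flip: N_def)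
  have "even N" using \<open>m \<ge> 1\<close> by (simp add: N_def)
  from pochhammer_reflect[OF this, of Y]
  have "2 ^ (C + d) * ([:- (2 ^ m), 1:] * pcompose H [:0, - 1:]) =
      2 ^ (C + d) * ([:0, 1:] * pcompose H [:- (2 ^ m), 1:])"
    unfolding 1 2 unfolding N
    by (simp add: Y_def two_power_poly power_add algebra_simps smult_diff_right)
  then show ?thesis by (subst (asm) mult_cancel_left) simp
qed

lemma coeff_even_power_poly:
  fixes X :: "'a::comm_ring_1 poly"
  defines "X \<equiv> [:0, 1:]"
  assumes "r \<le> b"
  shows "coeff (X ^ e * (X\<^sup>2 + 1) ^ b) (e + 2 * b - 2 * r) = of_nat (b choose r)"
proof -
  have X: "X ^ k = monom 1 k" for k by (simp add: X_def monom_altdef)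
  have "(X\<^sup>2 + 1) ^ b = (\<Sum>k\<le>b. of_nat (b choose k) * X ^ (2 * k))"
    by (simp add: binomial_ring power_mult)
  also have "\<dots> = (\<Sum>k\<le>b. monom (of_nat (b choose k)) (2 * k))"
    by (simp add: X of_nat_poly smult_monom)
  finally have "coeff ((X\<^sup>2 + 1) ^ b) (2 * (b - r)) = of_nat (b choose (b - r))"
    by (simp add: coeff_sum coeff_monom)
  moreover have "e + 2 * b - 2 * r = e + 2 * (b - r)" using assms by simp
  moreover have "b choose (b - r) = b choose r"
    using \<open>r \<le> b\<close> by (rule binomial_symmetric[symmetric])
  ultimately show ?thesis by (simp add: X coeff_monom_mult)
qed

section \<open>Two-adic valuations\<close>

text \<open>By the absorption identity, an odd binomial coefficient would force
  \<open>2 ^ a dvd r\<close>.\<close>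

lemma even_two_power_choose:
  assumes "0 < r" "r < 2 ^ a"
  shows "even ((2::nat) ^ a choose r)"
proof (rule ccontr)
  assume odd: "odd ((2::nat) ^ a choose r)"
  have "r * (2 ^ a choose r) = 2 ^ a * (2 ^ a - 1 choose (r - 1))"
    using assms times_binomial_minus1_eq[of r "2 ^ a"] by simp
  then have "2 ^ a dvd r * (2 ^ a choose r)" by simp
  with odd have "2 ^ a dvd r" by (simp add: coprime_dvd_mult_left_iff)
  with assms show False by (auto dest: dvd_imp_le)
qed

text \<open>By Pascal's rule neighbouring entries of this row sum to an even number, so oddness
  propagates from \<open>r = 0\<close>.\<close>

lemma odd_two_power_minus_1_choose:
  "r < 2 ^ a \<Longrightarrow> odd ((2::nat) ^ a - 1 choose r)"
proof (induction r)
  case (Suc r)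
  have "(2::nat) ^ a = Suc (2 ^ a - 1)" by simp
  then have "2 ^ a choose Suc r = (2 ^ a - 1 choose r) + (2 ^ a - 1 choose Suc r)"
    by (metis binomial_Suc_Suc)
  with Suc even_two_power_choose[of "Suc r" a] show ?case by auto
qed simp

text \<open>Cancel \<open>2 ^ v2 r\<close> in the absorption identity; what remains of
  \<open>r\<close>, and the binomial coefficient over \<open>2 ^ a - 1\<close>, are odd.\<close>

lemma two_power_choose_decompose:
  assumes "0 < r" "r \<le> 2 ^ a"
  shows "v2 r \<le> a" "\<exists>u. odd u \<and> (2 ^ a choose r) = 2 ^ (a - v2 r) * u"
proof -
  obtain w where w: "r = 2 ^ v2 r * w" "odd w"
    unfolding v2_def using multiplicity_decompose'[of r "2::nat"] assms by auto
  have "(2::nat) ^ v2 r dvd r" by (simp add: v2_def multiplicity_dvd)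
  then have "(2::nat) ^ v2 r \<le> 2 ^ a" using assms by (meson dvd_imp_le le_trans)
  then show le: "v2 r \<le> a" by simp
  have "2 ^ v2 r * (w * (2 ^ a choose r)) = r * (2 ^ a choose r)"
    by (subst (3) w(1)) simp
  also have "\<dots> = 2 ^ a * (2 ^ a - 1 choose (r - 1))"
    using assms times_binomial_minus1_eq[of r "2 ^ a"] by simp
  also have "\<dots> = 2 ^ v2 r * (2 ^ (a - v2 r) * (2 ^ a - 1 choose (r - 1)))"
    using le by (simp flip: power_add mult.assoc)
  finally have eq: "w * (2 ^ a choose r) = 2 ^ (a - v2 r) * (2 ^ a - 1 choose (r - 1))"
    by simp
  then have "2 ^ (a - v2 r) dvd w * (2 ^ a choose r)" by simp
  with w(2) have "2 ^ (a - v2 r) dvd (2 ^ a choose r)"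
    by (simp add: coprime_dvd_mult_right_iff)
  then obtain u where u: "(2 ^ a choose r) = 2 ^ (a - v2 r) * u" by blast
  with eq have "w * u = (2 ^ a - 1 choose (r - 1))" by simp
  moreover have "odd (2 ^ a - 1 choose (r - 1) :: nat)"
    using assms by (intro odd_two_power_minus_1_choose) simp
  ultimately have "odd u" by (metis even_mult_iff)
  with u show "\<exists>u. odd u \<and> (2 ^ a choose r) = 2 ^ (a - v2 r) * u" by blast
qed

lemma two_power_odd_part_cong:
  fixes h u :: int
  assumes "2 ^ b dvd h - 2 ^ e * u" "odd u" "e < b"
  shows "\<exists>w. odd w \<and> h = 2 ^ e * w"
proof -
  obtain t where "h - 2 ^ e * u = 2 ^ b * t" using assms(1) by blast
  moreover have "(2::int) ^ b = 2 ^ e * (2 * 2 ^ (b - e - 1))"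
    using \<open>e < b\<close> by (simp flip: power_add power_Suc)
  ultimately have "h = 2 ^ e * (u + 2 * (2 ^ (b - e - 1) * t))"
    by (simp add: algebra_simps)
  with \<open>odd u\<close> show ?thesis by (metis even_add even_mult_iff even_numeral)
qed

text \<open>The additive conclusion avoids truncated subtraction. The equation itself forces
  \<open>w \<ge> 0\<close>, and oddness excludes \<open>s = 0\<close>.\<close>

lemma v2_eqI:
  assumes "int s * 2 ^ e = 2 ^ f * w" "odd w"
  shows "v2 s + e = f"
proof -
  have "0 \<le> 2 ^ f * w" unfolding assms(1)[symmetric] by simp
  then have "0 \<le> w" by (simp add: zero_le_mult_iff)
  then obtain t where t: "w = int t" by (auto elim: nonneg_int_cases)
  then have "int (s * 2 ^ e) = int (2 ^ f * t)" using assms(1) by simp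
  then have eq: "s * 2 ^ e = 2 ^ f * t" by (simp only: of_nat_eq_iff)
  have "odd t" using assms(2) t by simp
  then have "t \<noteq> 0" by (rule contrapos_nn) simp
  then have "s \<noteq> 0" using eq by (intro notI) simp
  have "multiplicity 2 (s * 2 ^ e) = v2 s + e"
    using \<open>s \<noteq> 0\<close> by (simp add: prime_elem_multiplicity_mult_distrib v2_def)
  moreover have "multiplicity 2 (2 ^ f * t) = f"
    using \<open>odd t\<close> \<open>t \<noteq> 0\<close>
    by (simp add: prime_elem_multiplicity_mult_distrib not_dvd_imp_multiplicity_0)
  ultimately show ?thesis using eq by simp
qed

theorem theorem1p1:
  fixes n m k :: nat
  assumes "2 \<le> m" and "m \<le> n" and "2 \<le> k" and "k \<le> 2 ^ (m - 1) + 1"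
  shows "int (v2 (stirling (2 ^ n) (2 ^ m - k))) =
           2 ^ n - 2 ^ m - (int n - int m) * (2 ^ m - 2 * int (k div 2)) + int m - 2
           - int (v2 (k div 2)) + (int n - 1) * (if even k then 0 else 1)"
proof -
  define a where "a = m - 2"
  define d where "d = n - m"
  define r where "r = k div 2"
  have m: "m = a + 2" and n: "n = a + 2 + d" using assms by (auto simp: a_def d_def)
  have r: "0 < r" "r \<le> 2 ^ a" using assms by (auto simp: r_def m)
  have pow_m: "(2::nat) ^ m = 4 * 2 ^ a" by (simp add: m)
  define C where "C = (2::nat) ^ n - 2 ^ m"
  have C: "int C = 2 ^ n - 2 ^ m" using \<open>m \<le> n\<close> by (simp add: C_def of_nat_diff)
  let ?X = "[:0, 1:] :: int poly"
  obtain H c where H: "odd c" "pochhammer [:0, 2 ^ d:] (2 ^ n) = 2 ^ C * H"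
      "2 ^ Suc a dvd H - of_int c * (?X ^ (2 ^ Suc a) * (?X\<^sup>2 + 1) ^ (2 ^ a))"
    using pochhammer_rescale[of d a] unfolding C_def n m by blast
  have coeff_H: "int (stirling (2 ^ n) j) * 2 ^ (d * j) = 2 ^ C * coeff H j" for j
    using arg_cong[OF H(2), of "\<lambda>p. coeff p j"]
    by (simp add: coeff_pochhammer_linear two_power_poly power_mult)

  \<comment> \<open>This even index serves both parities: it is the wanted one for even
    \<open>k\<close> and its upper neighbour for odd \<open>k\<close>.\<close>
  let ?j = "2 ^ m - 2 * r"
  have j: "?j = 2 ^ Suc a + 2 * 2 ^ a - 2 * r" by (simp add: pow_m)
  obtain u :: nat where u: "odd u" "2 ^ a choose r = 2 ^ (a - v2 r) * u"
    using two_power_choose_decompose(2)[OF r] by blast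
  have "v2 r \<le> a" by (rule two_power_choose_decompose(1)[OF r])
  have "2 ^ Suc a dvd
      coeff (H - of_int c * (?X ^ (2 ^ Suc a) * (?X\<^sup>2 + 1) ^ (2 ^ a))) ?j"
    using H(3) unfolding two_power_poly const_poly_dvd_iff by blast
  also have "coeff (H - of_int c * (?X ^ (2 ^ Suc a) * (?X\<^sup>2 + 1) ^ (2 ^ a))) ?j =
      coeff H ?j - c * coeff (?X ^ (2 ^ Suc a) * (?X\<^sup>2 + 1) ^ (2 ^ a)) ?j"
    by (simp add: of_int_poly)
  also have "coeff (?X ^ (2 ^ Suc a) * (?X\<^sup>2 + 1) ^ (2 ^ a)) ?j = int (2 ^ a choose r)"
    unfolding j by (rule coeff_even_power_poly[OF r(2)])
  finally have "2 ^ Suc a dvd coeff H ?j - 2 ^ (a - v2 r) * (c * int u)"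
    by (simp add: u(2) mult_ac)
  then obtain w where w: "odd w" "coeff H ?j = 2 ^ (a - v2 r) * w"
    using two_power_odd_part_cong[of "Suc a" "coeff H ?j" "a - v2 r" "c * int u"] H(1) u(1)
    by (auto simp: less_Suc_eq_le)

  show ?thesis
  proof (cases "even k")
    case True
    then have k: "k = 2 * r" by (simp add: r_def)
    have "v2 (stirling (2 ^ n) ?j) + d * ?j = C + (a - v2 r)"
      by (rule v2_eqI[OF _ w(1)]) (simp add: coeff_H w(2) power_add)
    then have "int (v2 (stirling (2 ^ n) ?j)) + int d * int ?j = int C + (int a - int (v2 r))"
      using \<open>v2 r \<le> a\<close> by (simp flip: of_nat_add of_nat_mult of_nat_diff)
    moreover have "int ?j = 2 ^ m - 2 * int r" using r by (simp add: pow_m m of_nat_diff)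
    ultimately show ?thesis
      using True k C by (simp add: m n)
  next
    case False
    then have k: "k = 2 * r + 1" by (simp add: r_def)
    define i where "i = 2 ^ m - k"
    have i: "Suc i = ?j" "odd i" using r k by (auto simp: i_def pow_m)
    have "(2 ^ m)\<^sup>2 dvd 2 * coeff H i - 2 ^ m * int i * coeff H (Suc i)"
      using H(2) i(2) unfolding n
      by (intro odd_coeff_cong rescaled_functional_equation[where d = d and C = C]) (auto simp: m)
    moreover have "2 * coeff H i - 2 ^ m * int i * coeff H (Suc i) =
        2 * (coeff H i - 2 ^ (a + 1 + (a - v2 r)) * (int i * w))"
      unfolding i(1) w(2) by (simp add: m power_add)
    \<comment> \<open>The modulus is \<open>2 ^ (2 * a + 4)\<close>; cancelling the factor 2 in
      front of \<open>coeff H i\<close> leaves exponent \<open>2 * a + 3\<close>, still above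
      \<open>a + 1 + (a - v2 r)\<close>.\<close>
    moreover have "((2::int) ^ m)\<^sup>2 = 2 * 2 ^ (2 * a + 3)"
      unfolding m power_mult[symmetric] power_Suc[symmetric]
      by (rule arg_cong[where f = "power 2"]) simp
    ultimately have "2 ^ (2 * a + 3) dvd coeff H i - 2 ^ (a + 1 + (a - v2 r)) * (int i * w)"
      by (metis dvd_mult_cancel_left zero_neq_numeral)
    then obtain w' where w': "odd w'" "coeff H i = 2 ^ (a + 1 + (a - v2 r)) * w'"
      using two_power_odd_part_cong[of "2 * a + 3" "coeff H i" "a + 1 + (a - v2 r)" "int i * w"]
        i(2) w(1)
      by (auto simp: less_Suc_eq_le le_Suc_eq)
    have "v2 (stirling (2 ^ n) i) + d * i = C + (a + 1 + (a - v2 r))"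
      by (rule v2_eqI[OF _ w'(1)]) (simp add: coeff_H w'(2) power_add)
    then have "int (v2 (stirling (2 ^ n) i)) + int d * int i =
        int C + (int a + 1 + (int a - int (v2 r)))"
      using \<open>v2 r \<le> a\<close> by (simp flip: of_nat_add of_nat_mult of_nat_diff)
    moreover have "int i = 2 ^ m - 2 * int r - 1"
      using r k by (simp add: i_def pow_m m of_nat_diff)
    ultimately have "int (v2 (stirling (2 ^ n) i)) =
        int C + (int a + 1 + (int a - int (v2 r))) - int d * (2 ^ m - 2 * int r - 1)"
      by (simp only: eq_diff_eq)
    \<comment> \<open>Compared with even \<open>k\<close>, the coefficient gains
      \<open>a + 1\<close> and the lower index gains \<open>d\<close>, together
      \<open>n - 1\<close>.\<close>
    moreover have "int n = int a + 2 + int d" "int m = int a + 2" by (simp_all add: m n)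
    ultimately show ?thesis
      using False unfolding i_def r_def[symmetric] C by (simp add: algebra_simps)
  qed
qed

end
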